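(* Let $\Gamma=(V,E)$ be a finite simple graph and let $f\in\operatorname{St}(\Gamma)$ be an element with domain matching $M=\{E_1,\dots,E_k\}$ and image set $I=\{v_1,\dots,v_k\}$, with $xf=v_i$ if $x\in E_i$. Then $f$ is a regular element of $\operatorname{St}(\Gamma)$ if and only if the following two conditions hold: (1) (Transversal Condition) there exists an independent set of vertices $I'=\{u_1,\dots,u_k\}\subseteq V$ such that $u_i\in E_i$ for all $i\in\{1,\dots,k\}$; (2) (Covering Condition) there exists a matching $M'=\{E'_1,\dots,E'_k\}$ in $\Gamma$ of size $k$ such that $v_i\in E'_i$ for all $i\in\{1,\dots,k\}$.
   Context: For a finite simple graph $\Gamma=(V,E)$, the simplices of $\Gamma$ are the singletons $\{v\}$, $v\in V$, and the edges. A partial function $f:V\to V$ (acting on the right, composed left to right) is continuous if for every simplex $\sigma$ the full preimage $\sigma f^{-1}$ is a simplex or empty. $\operatorname{St}(\Gamma)$ is the semigroup of all continuous partial functions $f$ such that for every vertex $v$, the fiber $vf^{-1}$ is an edge or empty. Equivalently, $f\in\operatorname{St}(\Gamma)$ iff $\operatorname{Dom}(f)$ is the union of the edges of a matching $\{E_1,\dots,E_k\}$ (pairwise vertex-disjoint edges), $\operatorname{Im}(f)=\{v_1,\dots,v_k\}$ is an independent set (pairwise non-adjacent vertices) of size $k$, and both endpoints of $E_i$ are mapped to $v_i$. An element $f$ of a semigroup $S$ is regular if $fgf=f$ for some $g\in S$. *)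

theory Defs
  imports Main "HOL-Library.Disjoint_Sets"
begin

locale fin_simple_graph =
  fixes V :: "'a set" and E :: "'a set set"
  assumes finite_V: "finite V"
    and edge_subset: "e \<in> E \<Longrightarrow> e \<subseteq> V"
    and edge_card: "e \<in> E \<Longrightarrow> card e = 2"

definition simplices :: "'a set \<Rightarrow> 'a set set \<Rightarrow> 'a set set" where
  "simplices V E = {{v} | v. v \<in> V} \<union> E"

definition matching :: "'a set set \<Rightarrow> 'a set set \<Rightarrow> bool" where
  "matching E M \<longleftrightarrow> M \<subseteq> E \<and> disjoint M"

definition independent :: "'a set \<Rightarrow> 'a set set \<Rightarrow> 'a set \<Rightarrow> bool" where
  "independent V E I \<longleftrightarrow> I \<subseteq> V \<and> pairwise (\<lambda>x y. {x, y} \<notin> E) I"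

definition partial_on :: "'a set \<Rightarrow> ('a \<rightharpoonup> 'a) \<Rightarrow> bool" where
  "partial_on V f \<longleftrightarrow> dom f \<subseteq> V \<and> ran f \<subseteq> V"

definition preimage :: "('a \<rightharpoonup> 'a) \<Rightarrow> 'a set \<Rightarrow> 'a set" where
  "preimage f A = f -` (Some ` A)"

definition continuous_pf :: "'a set \<Rightarrow> 'a set set \<Rightarrow> ('a \<rightharpoonup> 'a) \<Rightarrow> bool" where
  "continuous_pf V E f \<longleftrightarrow>
    partial_on V f \<and> (\<forall>\<sigma>\<in>simplices V E. preimage f \<sigma> \<in> simplices V E \<or> preimage f \<sigma> = {})"

definition St :: "'a set \<Rightarrow> 'a set set \<Rightarrow> ('a \<rightharpoonup> 'a) set" where
  "St V E = {f. continuous_pf V E f \<and> (\<forall>v\<in>V. preimage f {v} \<in> E \<or> preimage f {v} = {})}"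

text \<open>Functions act on the right, so the product \<open>fg\<close> applies \<open>f\<close> first.\<close>

definition pf_mult :: "('a \<rightharpoonup> 'a) \<Rightarrow> ('a \<rightharpoonup> 'a) \<Rightarrow> ('a \<rightharpoonup> 'a)" where
  "pf_mult f g = g \<circ>\<^sub>m f"

definition regular_element :: "('s \<Rightarrow> 's \<Rightarrow> 's) \<Rightarrow> 's set \<Rightarrow> 's \<Rightarrow> bool" where
  "regular_element mult S f \<longleftrightarrow> f \<in> S \<and> (\<exists>g\<in>S. mult (mult f g) f = f)"

lemma mem_preimage: "x \<in> preimage f A \<longleftrightarrow> (\<exists>y\<in>A. f x = Some y)"
  unfolding preimage_def by auto

lemma pf_mult_assoc: "pf_mult (pf_mult f g) h = pf_mult f (pf_mult g h)"
  unfolding pf_mult_def by (rule ext) (auto simp: map_comp_def split: option.splits)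

lemma preimage_pf_mult: "preimage (pf_mult f g) A = preimage f (preimage g A)"
  unfolding preimage_def pf_mult_def
  by (auto simp: map_comp_def image_iff split: option.splits)

lemma preimage_empty [simp]: "preimage f {} = {}"
  by (auto simp: mem_preimage)

context fin_simple_graph
begin

lemma fibre_edge:
  assumes "f \<in> St V E" "f x = Some v"
  shows "v \<in> V" "preimage f {v} \<in> E"
proof -
  show v: "v \<in> V" using assms unfolding St_def continuous_pf_def partial_on_def ran_def by auto
  have "x \<in> preimage f {v}" using assms by (simp add: mem_preimage)
  then show "preimage f {v} \<in> E" using assms(1) v unfolding St_def by auto
qed

lemma independent_ran:
  assumes f: "f \<in> St V E"
  shows "independent V E (ran f)"
  unfolding independent_def pairwise_def
proof (intro conjI ballI impI notI)
  show "ran f \<subseteq> V" using f unfolding St_def continuous_pf_def partial_on_def by auto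
next
  fix u v assume u: "u \<in> ran f" and v: "v \<in> ran f" and ne: "u \<noteq> v" and e: "{u, v} \<in> E"
  obtain x where x: "f x = Some u" using u by (auto simp: ran_def)
  obtain y where y: "f y = Some v" using v by (auto simp: ran_def)
  have c: "card (preimage f {u}) = 2" "card (preimage f {v}) = 2"
    using fibre_edge(2)[OF f x] fibre_edge(2)[OF f y] edge_card by auto
  then have fin: "finite (preimage f {u})" "finite (preimage f {v})"
    using card.infinite by fastforce+
  have un: "preimage f {u, v} = preimage f {u} \<union> preimage f {v}"
    by (auto simp: mem_preimage)
  have "preimage f {u} \<inter> preimage f {v} = {}" using ne by (auto simp: mem_preimage)
  then have "card (preimage f {u, v}) = 4" using c fin un by (simp add: card_Un_disjoint)
  moreover have "preimage f {u, v} \<in> simplices V E \<or> preimage f {u, v} = {}"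
    using f e unfolding St_def continuous_pf_def simplices_def by auto
  ultimately show False using edge_card by (auto simp: simplices_def)
qed

lemma pf_mult_St:
  assumes f: "f \<in> St V E" and g: "g \<in> St V E"
  shows "pf_mult f g \<in> St V E"
proof -
  have cont: "continuous_pf V E f" "continuous_pf V E g" using f g by (auto simp: St_def)
  have "partial_on V (pf_mult f g)"
  proof -
    have "dom (pf_mult f g) \<subseteq> dom f" "ran (pf_mult f g) \<subseteq> ran g"
      by (auto simp: pf_mult_def map_comp_def ran_def split: option.splits)
    then show ?thesis using cont unfolding continuous_pf_def partial_on_def by blast
  qed
  moreover have "preimage (pf_mult f g) s \<in> simplices V E \<or> preimage (pf_mult f g) s = {}"
    if "s \<in> simplices V E" for s
    unfolding preimage_pf_mult using cont that unfolding continuous_pf_def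
    by (metis preimage_empty)
  moreover have "preimage (pf_mult f g) {v} \<in> E \<or> preimage (pf_mult f g) {v} = {}"
    if v: "v \<in> V" for v
  proof (cases "preimage f (preimage g {v}) = {}")
    case False
    then obtain x y where x: "f x = Some y" "y \<in> preimage g {v}" by (auto simp: mem_preimage)
    then have e: "preimage g {v} \<in> E" using g v by (auto simp: St_def)
    then obtain a b where ab: "preimage g {v} = {a, b}" "a \<noteq> b"
      using edge_card[OF e] by (auto simp: card_2_iff)
    have un: "z = y" if "z \<in> {a, b}" "z \<in> ran f" for z
      using that x e ab independent_ran[OF f] unfolding independent_def pairwise_def
      by (metis insertE insert_commute ranI singletonD)
    then have "preimage f (preimage g {v}) = preimage f {y}"
    proof (intro equalityI subsetI)
      fix t assume "t \<in> preimage f (preimage g {v})"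
      then obtain z where z: "f t = Some z" "z \<in> preimage g {v}" by (auto simp: mem_preimage)
      then have "z = y" using un ab by (metis ranI)
      then show "t \<in> preimage f {y}" using z by (simp add: mem_preimage)
    qed (use x in \<open>auto simp: mem_preimage\<close>)
    then show ?thesis using fibre_edge(2)[OF f x(1)] by (simp add: preimage_pf_mult)
  qed (simp add: preimage_pf_mult)
  ultimately show ?thesis by (simp add: St_def continuous_pf_def)
qed

text \<open>Every element of \<open>St V E\<close> is given by a domain matching and an independent image.\<close>

lemma St_iff_matching:
  "f \<in> St V E \<longleftrightarrow>
    (\<exists>k (D :: nat \<Rightarrow> 'a set) v. inj_on D {1..k} \<and> matching E (D ` {1..k}) \<and>
      inj_on v {1..k} \<and> independent V E (v ` {1..k}) \<and>
      dom f = \<Union>(D ` {1..k}) \<and> ran f = v ` {1..k} \<and>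
      (\<forall>i\<in>{1..k}. \<forall>x\<in>D i. f x = Some (v i)))" (is "_ \<longleftrightarrow> ?R")
proof
  assume f: "f \<in> St V E"
  have ind: "independent V E (ran f)" by (rule independent_ran[OF f])
  then have "finite (ran f)" using finite_V finite_subset unfolding independent_def by blast
  then obtain v where v: "bij_betw v {1..card (ran f)} (ran f)"
    using ex_bij_betw_nat_finite_1 by blast
  define k where "k = card (ran f)"
  define D where "D = (\<lambda>i. preimage f {v i})"
  have v_ran: "v ` {1..k} = ran f" and v_inj: "inj_on v {1..k}"
    using v by (auto simp: bij_betw_def k_def)
  have D_E: "D i \<in> E" "D i \<noteq> {}" if "i \<in> {1..k}" for i
  proof -
    have "v i \<in> ran f" using that v_ran by auto
    then obtain x where x: "f x = Some (v i)" by (auto simp: ran_def)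
    show "D i \<in> E" using fibre_edge(2)[OF f x] by (simp add: D_def)
    show "D i \<noteq> {}" using x by (auto simp: D_def mem_preimage)
  qed
  have dis: "D i \<inter> D j = {}" if "i \<in> {1..k}" "j \<in> {1..k}" "i \<noteq> j" for i j
  proof -
    have "v i \<noteq> v j" using that v_inj by (metis inj_onD)
    then show ?thesis by (auto simp: D_def mem_preimage)
  qed
  have "inj_on D {1..k}"
  proof (rule inj_onI, rule ccontr)
    fix i j assume "i \<in> {1..k}" "j \<in> {1..k}" "D i = D j" "i \<noteq> j"
    then show False using dis[of i j] D_E(2)[of i] by blast
  qed
  moreover have "matching E (D ` {1..k})"
    unfolding matching_def disjoint_def using D_E(1) dis by blast
  moreover have "dom f = \<Union>(D ` {1..k})"
  proof (intro equalityI subsetI)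
    fix x assume "x \<in> dom f"
    then obtain y where y: "f x = Some y" by auto
    then have "y \<in> v ` {1..k}" using v_ran by (auto simp: ran_def)
    then show "x \<in> \<Union>(D ` {1..k})" using y by (auto simp: D_def mem_preimage)
  qed (auto simp: D_def mem_preimage)
  moreover have "\<forall>i\<in>{1..k}. \<forall>x\<in>D i. f x = Some (v i)" by (auto simp: D_def mem_preimage)
  ultimately show ?R using v_ran v_inj ind
    by (intro exI[of _ k] exI[of _ D] exI[of _ v]) simp
next
  assume ?R
  then obtain k and D :: "nat \<Rightarrow> 'a set" and v where
    mat: "matching E (D ` {1..k})" and v_inj: "inj_on v {1..k}"
    and ind: "independent V E (v ` {1..k})" and dom: "dom f = \<Union>(D ` {1..k})"
    and ran: "ran f = v ` {1..k}" and fD: "\<forall>i\<in>{1..k}. \<forall>x\<in>D i. f x = Some (v i)"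
    by (elim exE conjE) (rule that)
  have DE: "D i \<in> E" if "i \<in> {1..k}" for i using mat that unfolding matching_def by blast
  have fib: "preimage f {v i} = D i" if i: "i \<in> {1..k}" for i
  proof (intro equalityI subsetI)
    fix x assume "x \<in> preimage f {v i}"
    then have x: "f x = Some (v i)" by (simp add: mem_preimage)
    then obtain j where j: "j \<in> {1..k}" "x \<in> D j" using dom by blast
    then have "v j = v i" using fD x by auto
    then show "x \<in> D i" using j i v_inj by (metis inj_onD)
  qed (use fD i in \<open>auto simp: mem_preimage\<close>)
  have nofib: "preimage f {w} = {}" if "w \<notin> ran f" for w
    using that by (auto simp: mem_preimage ran_def)
  have fibE: "preimage f {w} \<in> E \<or> preimage f {w} = {}" for w
    using fib nofib DE ran by (metis imageE)
  have edge: "preimage f e \<in> simplices V E \<or> preimage f e = {}" if e: "e \<in> E" for e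
  proof -
    obtain a b where ab: "e = {a, b}" "a \<noteq> b" using edge_card[OF e] by (auto simp: card_2_iff)
    have "a \<notin> ran f \<or> b \<notin> ran f"
      using ind ran ab e unfolding independent_def pairwise_def by auto
    moreover have "preimage f e = preimage f {a} \<union> preimage f {b}"
      using ab by (auto simp: mem_preimage)
    ultimately have "preimage f e = preimage f {a} \<or> preimage f e = preimage f {b}"
      using nofib by auto
    then show ?thesis using fibE[of a] fibE[of b] by (auto simp: simplices_def)
  qed
  have "dom f \<subseteq> V" unfolding dom using DE edge_subset by blast
  moreover have "ran f \<subseteq> V" using ind ran by (simp add: independent_def)
  ultimately have "partial_on V f" by (simp add: partial_on_def)
  then show "f \<in> St V E"
    using edge fibE by (force simp: St_def continuous_pf_def simplices_def)
qed

end

end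

theory Submission
  imports Defs
begin

text \<open>
  The equation \<open>f g f = f\<close> says that \<open>g\<close> restricts to a section of \<open>f\<close> over the image of \<open>f\<close>:
  it sends each \<open>v i\<close> to some point \<open>u i\<close> of the fibre \<open>D i\<close> (lemma \<open>inner_inverse_iff\<close>).
  What remains is to decide when such a section extends to an element of \<open>St V E\<close>. If it does, then
  the points \<open>u i\<close> lie in the image of \<open>g\<close>, which is independent, and the fibres of \<open>g\<close> over
  them are disjoint edges through the \<open>v i\<close>. These are the transversal and the covering
  condition. Conversely, a transversal \<open>u\<close> and a covering matching \<open>D'\<close> are the
  data that determine an element of \<open>St V E\<close> collapsing each \<open>D' i\<close> to \<open>u i\<close> (lemma
  \<open>St_collapse_exists\<close>), and this element is a section because \<open>v i\<close> lies in \<open>D' i\<close>.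
\<close>

text \<open>
  Evaluating \<open>f g f\<close> at a point of the fibre over \<open>y\<close> gives the value of \<open>f\<close> at the
  image of \<open>y\<close> under \<open>g\<close>, so only the behaviour of \<open>g\<close> on the image of \<open>f\<close> matters.
\<close>

lemma inner_inverse_iff:
  "pf_mult (pf_mult f g) f = f \<longleftrightarrow> (\<forall>y\<in>ran f. \<exists>z. g y = Some z \<and> f z = Some y)"
proof
  assume eq: "pf_mult (pf_mult f g) f = f"
  show "\<forall>y\<in>ran f. \<exists>z. g y = Some z \<and> f z = Some y"
  proof
    fix y assume "y \<in> ran f"
    then obtain x where x: "f x = Some y" by (auto simp: ran_def)
    have "pf_mult (pf_mult f g) f x = Some y" using eq x by simp
    then show "\<exists>z. g y = Some z \<and> f z = Some y"
      using x by (auto simp: pf_mult_def map_comp_def split: option.splits)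
  qed
next
  assume sec: "\<forall>y\<in>ran f. \<exists>z. g y = Some z \<and> f z = Some y"
  show "pf_mult (pf_mult f g) f = f"
  proof
    fix x show "pf_mult (pf_mult f g) f x = f x"
    proof (cases "f x")
      case (Some y)
      then obtain z where "g y = Some z" "f z = Some y" using sec by (meson ranI)
      then show ?thesis using Some by (simp add: pf_mult_def map_comp_def)
    qed (simp add: pf_mult_def map_comp_def)
  qed
qed

text \<open>
  The members of a matching are pairwise disjoint and the indexing \<open>M\<close> is injective, so each
  covered vertex has exactly one index and the collapsing map is well defined.
\<close>

lemma (in fin_simple_graph) St_collapse_exists:
  fixes M :: "nat \<Rightarrow> 'a set"
  assumes M_inj: "inj_on M {1..k}" and M: "matching E (M ` {1..k})"
    and u_inj: "inj_on u {1..k}" and u: "independent V E (u ` {1..k})"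
  obtains g where "g \<in> St V E" "\<And>i x. i \<in> {1..k} \<Longrightarrow> x \<in> M i \<Longrightarrow> g x = Some (u i)"
proof -
  define g where "g x = (if x \<in> \<Union>(M ` {1..k})
      then Some (u (SOME i. i \<in> {1..k} \<and> x \<in> M i)) else None)" for x
  have g_M: "g x = Some (u i)" if i: "i \<in> {1..k}" and x: "x \<in> M i" for i x
  proof -
    have "j = i" if "j \<in> {1..k} \<and> x \<in> M j" for j
    proof -
      have "M j = M i"
        using M that i x unfolding matching_def disjoint_def by blast
      then show ?thesis using M_inj that i by (meson inj_onD)
    qed
    then have "(SOME j. j \<in> {1..k} \<and> x \<in> M j) = i"
      using i x by (intro some_equality) auto
    then show ?thesis using i x by (auto simp: g_def)
  qed
  have dom: "dom g = \<Union>(M ` {1..k})" by (auto simp: g_def dom_def)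
  have "ran g = u ` {1..k}"
  proof (intro equalityI subsetI)
    fix y assume "y \<in> ran g"
    then obtain x where x: "g x = Some y" by (auto simp: ran_def)
    then obtain i where "i \<in> {1..k}" "x \<in> M i" using dom by blast
    then show "y \<in> u ` {1..k}" using g_M x by auto
  next
    fix y assume "y \<in> u ` {1..k}"
    then obtain i where i: "i \<in> {1..k}" "y = u i" by blast
    \<comment> \<open>Every point of \<open>u\<close> is hit because edges are nonempty.\<close>
    have "M i \<in> E" using M i(1) by (auto simp: matching_def)
    then have "M i \<noteq> {}" using edge_card by fastforce
    then show "y \<in> ran g" using g_M i by (metis ex_in_conv ranI)
  qed
  then have "g \<in> St V E"
    using M_inj M u_inj u dom g_M unfolding St_iff_matching
    by (intro exI[of _ k] exI[of _ M] exI[of _ u]) simp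
  then show ?thesis using g_M that by blast
qed

theorem theorem7p1:
  fixes V :: "'a set" and E :: "'a set set" and f :: "'a \<rightharpoonup> 'a"
    and k :: nat and D :: "nat \<Rightarrow> 'a set" and v :: "nat \<Rightarrow> 'a"
  assumes "fin_simple_graph V E"
    and "f \<in> St V E"
    and "inj_on D {1..k}" and "matching E (D ` {1..k})" and "dom f = \<Union>(D ` {1..k})"
    and "inj_on v {1..k}" and "ran f = v ` {1..k}"
    and "\<And>i x. i \<in> {1..k} \<Longrightarrow> x \<in> D i \<Longrightarrow> f x = Some (v i)"
  shows "regular_element pf_mult (St V E) f \<longleftrightarrow>
    (\<exists>u :: nat \<Rightarrow> 'a. independent V E (u ` {1..k}) \<and> (\<forall>i\<in>{1..k}. u i \<in> D i)) \<and>
    (\<exists>D' :: nat \<Rightarrow> 'a set. inj_on D' {1..k} \<and> matching E (D' ` {1..k}) \<and>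
      (\<forall>i\<in>{1..k}. v i \<in> D' i))"
    (is "?reg \<longleftrightarrow> ?transversal \<and> ?covering")
proof -
  interpret fin_simple_graph V E by fact
  note dom = assms(5) and v_inj = assms(6) and ran = assms(7) and f_D = assms(8)
  have D_fibre: "x \<in> D i" if i: "i \<in> {1..k}" and x: "f x = Some (v i)" for i x
  proof -
    obtain j where j: "j \<in> {1..k}" "x \<in> D j" using x dom by blast
    then have "v j = v i" using f_D x by simp
    then show ?thesis using j i v_inj by (metis inj_onD)
  qed
  show ?thesis
  proof
    assume ?reg
    then obtain g where g: "g \<in> St V E" and "pf_mult (pf_mult f g) f = f"
      by (auto simp: regular_element_def)
    then have "\<forall>i\<in>{1..k}. \<exists>z. g (v i) = Some z \<and> f z = Some (v i)"
      using ran by (auto simp: inner_inverse_iff)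
    then obtain u where gu: "\<And>i. i \<in> {1..k} \<Longrightarrow> g (v i) = Some (u i)"
      and fu: "\<And>i. i \<in> {1..k} \<Longrightarrow> f (u i) = Some (v i)"
      by metis
    have u_ne: "u i \<noteq> u j" if "i \<in> {1..k}" "j \<in> {1..k}" "i \<noteq> j" for i j
      using that fu v_inj by (metis inj_onD option.inject)
    have "u ` {1..k} \<subseteq> ran g" using gu ranI by fast
    then have "independent V E (u ` {1..k})"
      using independent_ran[OF g] pairwise_subset unfolding independent_def by blast
    then have ?transversal using D_fibre fu by blast
    moreover have ?covering
    proof (intro exI conjI ballI)
      let ?M = "\<lambda>i. preimage g {u i}"
      show v_M: "v i \<in> ?M i" if "i \<in> {1..k}" for i
        using gu[OF that] by (simp add: mem_preimage)
      have dis: "?M i \<inter> ?M j = {}" if "i \<in> {1..k}" "j \<in> {1..k}" "i \<noteq> j" for i j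
        using u_ne[OF that] by (auto simp: mem_preimage)
      show "inj_on ?M {1..k}"
      proof (rule inj_onI, rule ccontr)
        fix i j assume "i \<in> {1..k}" "j \<in> {1..k}" "?M i = ?M j" "i \<noteq> j"
        then show False using dis[of i j] v_M[of i] by blast
      qed
      show "matching E (?M ` {1..k})"
        unfolding matching_def disjoint_def
        using fibre_edge(2)[OF g gu] dis by fastforce
    qed
    ultimately show "?transversal \<and> ?covering" by blast
  next
    assume "?transversal \<and> ?covering"
    then obtain u D' where u: "independent V E (u ` {1..k})" "\<And>i. i \<in> {1..k} \<Longrightarrow> u i \<in> D i"
      and D': "inj_on D' {1..k}" "matching E (D' ` {1..k})" "\<And>i. i \<in> {1..k} \<Longrightarrow> v i \<in> D' i"
      by blast
    have fu: "f (u i) = Some (v i)" if "i \<in> {1..k}" for i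
      using f_D u(2) that by blast
    have "inj_on u {1..k}"
    proof (rule inj_onI)
      fix i j assume "i \<in> {1..k}" "j \<in> {1..k}" "u i = u j"
      then show "i = j" using fu[of i] fu[of j] inj_onD[OF v_inj] by auto
    qed
    then obtain g where g: "g \<in> St V E"
      and g_D': "\<And>i x. i \<in> {1..k} \<Longrightarrow> x \<in> D' i \<Longrightarrow> g x = Some (u i)"
      using St_collapse_exists[OF D'(1,2) _ u(1)] by blast
    then have "pf_mult (pf_mult f g) f = f"
      using D'(3) fu ran by (auto simp: inner_inverse_iff)
    then show ?reg using \<open>f \<in> St V E\<close> g by (auto simp: regular_element_def)
  qed
qed

end
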